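(* Let $U\sim\mathrm{CP}(\lambda,\boldsymbol{\mu})$ be a compound Poisson random variable with $2\theta_1>\theta_0$ and let $$ \delta=\frac{2\theta_1-\theta_0}{2\sqrt{\pi}\exp\left\{\frac{3}{2}(2\theta_1-\theta_0)\right\}}\,. $$ Then $$ M_0^{(K)}(U)\leq2\sqrt{\frac{2}{\delta}}\quad\text{ and }\quad M_1^{(K)}(U)\leq\frac{1}{2\delta}\left[1+\log^+(\pi\delta)\right]\,. $$
   Context: Compound Poisson distribution: for $\lambda>0$ and a probability distribution $\boldsymbol{\mu}=(\mu_1,\mu_2,\ldots)$ on $\{1,2,\ldots\}$, $U\sim\mathrm{CP}(\lambda,\boldsymbol{\mu})$ means that $U$ is equal in distribution to $\sum_{j=1}^N X_j$, where $N\sim\mathrm{Po}(\lambda)$ is Poisson with mean $\lambda$ and $X_1,X_2,\ldots$ are i.i.d., independent of $N$, with $\mathbb{P}(X_1=k)=\mu_k$. Write $\lambda_j=\lambda\mu_j$, $\theta_0=\sum_{j=1}^\infty j\lambda_j$ and $\theta_1=\sum_{j=1}^\infty j(j-1)\lambda_j$; both are assumed finite. Stein equation: let $\mathbb{Z}^+=\{0,1,2,\ldots\}$ and $\mathcal{H}_K=\{I(\cdot\leq y):y\in\mathbb{Z}^+\}$. For $h\in\mathcal{H}_K$, let $f_h$ be the bounded solution of $$h(x)-\mathbb{E}h(U)=\sum_{j=1}^\infty j\lambda_jf_h(x+j)-xf_h(x),\qquad x\in\mathbb{Z}^+;$$ this equation does not involve $f_h(0)$, and $f_h$ is considered on $\{1,2,\ldots\}$.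 For $l=0,1$ let $$M_l^{(K)}(U)=\sup_{h\in\mathcal{H}_K}\ \sup_{x\geq1}|\Delta^lf_h(x)|,$$ where $\Delta f(x)=f(x+1)-f(x)$ and $\Delta^0f=f$. Finally, $\log^+$ is the positive part of the natural logarithm. *)

theory Defs
  imports "HOL-Probability.Probability"
begin

text \<open>
  The law of \<open>X\<^sub>1 + \<dots> + X\<^sub>N\<close> with \<open>N\<close> Poisson of mean \<open>lam\<close> and i.i.d. summands of law \<open>mu\<close>,
  independent of \<open>N\<close>. That \<open>lam > 0\<close> and that \<open>mu\<close> lives on \<open>{1, 2, \<dots>}\<close> (i.e. \<open>pmf mu 0 = 0\<close>)
  are hypotheses wherever it is used.
\<close>

definition compound_poisson_pmf :: "real \<Rightarrow> nat pmf \<Rightarrow> nat pmf" where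
  "compound_poisson_pmf lam mu =
     do {n \<leftarrow> poisson_pmf lam; xs \<leftarrow> replicate_pmf n mu; return_pmf (sum_list xs)}"

definition cp_rate :: "real \<Rightarrow> nat pmf \<Rightarrow> nat \<Rightarrow> real" where
  "cp_rate lam mu j = lam * pmf mu j"

definition cp_theta0 :: "real \<Rightarrow> nat pmf \<Rightarrow> real" where
  "cp_theta0 lam mu = (\<Sum>\<^sub>\<infinity>j\<in>{1..}. real j * cp_rate lam mu j)"

definition cp_theta1 :: "real \<Rightarrow> nat pmf \<Rightarrow> real" where
  "cp_theta1 lam mu = (\<Sum>\<^sub>\<infinity>j\<in>{1..}. real j * (real j - 1) * cp_rate lam mu j)"

definition kolmogorov_tests :: "(nat \<Rightarrow> real) set" where
  "kolmogorov_tests = range (\<lambda>y. indicator {..y})"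

definition bounded_stein_solution ::
    "real \<Rightarrow> nat pmf \<Rightarrow> (nat \<Rightarrow> real) \<Rightarrow> (nat \<Rightarrow> real) \<Rightarrow> bool" where
  "bounded_stein_solution lam mu h f \<longleftrightarrow>
     bounded (f ` {1..}) \<and>
     (\<forall>x. h x - measure_pmf.expectation (compound_poisson_pmf lam mu) h =
          (\<Sum>\<^sub>\<infinity>j\<in>{1..}. real j * cp_rate lam mu j * f (x + j)) - real x * f x)"

text \<open>
  The equation leaves \<open>f 0\<close> undetermined, so it is fixed to be \<open>0\<close> here; only the values on
  \<open>{1, 2, \<dots>}\<close> are used below.
\<close>

definition stein_solution :: "real \<Rightarrow> nat pmf \<Rightarrow> (nat \<Rightarrow> real) \<Rightarrow> nat \<Rightarrow> real" where
  "stein_solution lam mu h = (THE f. bounded_stein_solution lam mu h f \<and> f 0 = 0)"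

definition fwd_diff :: "(nat \<Rightarrow> real) \<Rightarrow> nat \<Rightarrow> real" where
  "fwd_diff f x = f (x + 1) - f x"

text \<open>The suprema are taken in the extended reals, so that they carry no junk value when infinite.\<close>

definition kolmogorov_stein_factor :: "nat \<Rightarrow> real \<Rightarrow> nat pmf \<Rightarrow> ereal" where
  "kolmogorov_stein_factor l lam mu =
     (SUP h\<in>kolmogorov_tests. SUP x\<in>{1..}. ereal \<bar>(fwd_diff ^^ l) (stein_solution lam mu h) x\<bar>)"

definition log_plus :: "real \<Rightarrow> real" where
  "log_plus x = max 0 (ln x)"

end

theory Submission
  imports Defs "HOL-Complex_Analysis.Complex_Analysis"
begin

text \<open>
  Write \<open>\<Lambda> z = \<Sum>\<^sub>j \<lambda>\<^sub>j z\<^sup>j\<close> and \<open>w\<^sub>p = 1 - p (1 - z)\<close> for the points of the chord from \<open>1\<close> to \<open>z\<close>. The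
  solution for the test \<open>I(\<cdot> \<le> y)\<close> is the coefficient of \<open>z\<^sup>y\<close> in
  \<open>F\<^sub>x z = \<integral>\<^sub>0\<^sup>1 w\<^sub>p\<^bsup>x-1\<^esup> exp (\<Lambda> z - \<Lambda> w\<^sub>p) dp\<close>: since the integrand of \<open>\<Sum>\<^sub>j j \<lambda>\<^sub>j F\<^bsub>x+j\<^esub> - x F\<^sub>x\<close> is an exact
  derivative in \<open>p\<close>, that combination equals \<open>(z\<^sup>x - E z\<^sup>U) / (1 - z)\<close>, whose coefficient of \<open>z\<^sup>y\<close> is
  \<open>I(x \<le> y) - P(U \<le> y)\<close>. By Cauchy's inequality a coefficient is at most \<open>sup \<bar>F\<^sub>x\<bar>\<close> over the unit
  disc. There \<open>\<bar>\<Lambda>' w - \<theta>\<^sub>0\<bar> \<le> \<theta>\<^sub>1 \<bar>1 - w\<bar>\<close> and \<open>\<bar>\<Lambda>' w\<bar> \<le> \<theta>\<^sub>0\<close>; integrated along the chord, with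
  \<open>D = 2 \<theta>\<^sub>1 - \<theta>\<^sub>0 > 0\<close>, they give
  \<open>Re (\<Lambda> z - \<Lambda> w\<^sub>p) \<le> min (D\<^sup>2 / (2 \<theta>\<^sub>1)) (2 \<theta>\<^sub>0) \<le> 0.74 D\<close>. Hence \<open>\<bar>f\<bar> \<le> exp (0.74 D)\<close> and
  \<open>\<bar>\<Delta>f\<bar> \<le> 2 exp (0.74 D)\<close>, which already lie below the claimed bounds, even without the logarithm.
\<close>

section \<open>Coefficients of bounded holomorphic functions on the unit disc\<close>

text \<open>Cauchy's inequality on the circle of radius r < 1 bounds the coefficient by
  \<open>B / r ^ n\<close>; then r tends to 1.\<close>

lemma norm_fps_expansion_nth_le:
  assumes hol: "f holomorphic_on ball 0 1" and B: "\<And>z. norm z < 1 \<Longrightarrow> norm (f z) \<le> B"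
  shows "norm (fps_nth (fps_expansion f 0) n) \<le> B"
proof -
  let ?c = "norm (fps_nth (fps_expansion f 0) n)"
  have "r ^ n * ?c \<le> B" if r: "0 < r" "r < 1" for r :: real
  proof -
    have "norm ((deriv ^^ n) f 0) \<le> fact n * B / r ^ n"
    proof (rule Cauchy_inequality)
      show "f holomorphic_on ball 0 r"
        using hol r by (rule_tac holomorphic_on_subset) auto
      show "continuous_on (cball 0 r) f"
        using hol r by (intro holomorphic_on_imp_continuous_on, rule_tac holomorphic_on_subset) auto
    qed (use r B in auto)
    then show ?thesis
      using r by (simp add: fps_expansion_def norm_divide field_simps)
  qed
  then have "\<forall>\<^sub>F r in at_left 1. r ^ n * ?c \<le> B"
    using eventually_at_left_real[of 0 1] by (auto elim!: eventually_mono)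
  moreover have "((\<lambda>r. r ^ n * ?c) \<longlongrightarrow> 1 ^ n * ?c) (at_left 1)"
    by (intro tendsto_intros)
  ultimately show ?thesis
    using tendsto_upperbound by fastforce
qed

lemma norm_one_minus_power_le:
  fixes w :: complex
  assumes "norm w \<le> 1"
  shows "norm (1 - w ^ n) \<le> real n * norm (1 - w)"
  using norm_power_diff[of 1 w n] assms by simp

subsection \<open>The jump generating function along chords\<close>

definition chord :: "complex \<Rightarrow> real \<Rightarrow> complex" where
  "chord z p = 1 - of_real p * (1 - z)"

lemma chord_0 [simp]: "chord z 0 = 1" and chord_1 [simp]: "chord z 1 = z"
  by (simp_all add: chord_def)

lemma norm_chord: 
  assumes "0 \<le> p" "p \<le> 1" shows "norm (chord z p) \<le> 1 - p * (1 - norm z)"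
proof -
  have "chord z p = of_real (1 - p) + of_real p * z"
    by (simp add: chord_def algebra_simps)
  also have "norm \<dots> \<le> (1 - p) + p * norm z"
    using assms by (intro order_trans[OF norm_triangle_ineq]) (simp add: norm_mult del: of_real_diff)
  finally show ?thesis by (simp add: algebra_simps)
qed

lemma norm_chord_le: "0 \<le> p \<Longrightarrow> p \<le> 1 \<Longrightarrow> norm z \<le> 1 \<Longrightarrow> norm (chord z p) \<le> 1"
  by (rule order_trans[OF norm_chord]) simp_all

text \<open>At p = 0 the chord sits at the boundary point 1, where \<open>\<Lambda>\<close> is only
  known to be continuous. For p > 0 it lies in the open disc, where \<open>\<Lambda>\<close> is
  holomorphic.\<close>

lemma norm_chord_less: "0 < p \<Longrightarrow> p \<le> 1 \<Longrightarrow> norm z < 1 \<Longrightarrow> norm (chord z p) < 1"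
  by (rule order_le_less_trans[OF norm_chord]) simp_all

lemma continuous_on_chord [continuous_intros]:
  "continuous_on A f \<Longrightarrow> continuous_on A g \<Longrightarrow> continuous_on A (\<lambda>x. chord (f x) (g x))"
  unfolding chord_def by (intro continuous_intros)

text \<open>Separates the analysis from the probability: only the rates and their first two
  factorial moments enter. Ordinary series over all naturals replace the unordered sums over
  \<open>{1..}\<close>, to suit power series.\<close>

locale jump_rates =
  fixes rate :: "nat \<Rightarrow> real"
  assumes rate_nonneg: "rate j \<ge> 0" and rate_0: "rate 0 = 0"
    and summable_theta0: "summable (\<lambda>j. real j * rate j)"
    and summable_theta1: "summable (\<lambda>j. real j * (real j - 1) * rate j)"
begin

definition \<theta>0 :: real where "\<theta>0 = (\<Sum>j. real j * rate j)"
definition \<theta>1 :: real where "\<theta>1 = (\<Sum>j. real j * (real j - 1) * rate j)"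

definition \<Lambda> :: "complex \<Rightarrow> complex" where
  "\<Lambda> z = (\<Sum>j. of_real (rate j) * z ^ j)"

text \<open>Given by its series rather than by \<open>deriv\<close>, so that it also makes sense on
  the boundary, in particular at 1, where its value is \<open>\<theta>0\<close>.\<close>

definition \<Lambda>' :: "complex \<Rightarrow> complex" where
  "\<Lambda>' z = (\<Sum>j. of_real (real j * rate j) * z ^ (j - 1))"

lemma summable_rate: "summable rate"
proof (rule summable_comparison_test'[OF summable_theta0])
  show "norm (rate j) \<le> real j * rate j" for j
    using rate_nonneg[of j] rate_0 by (cases "j = 0") (auto simp: mult_le_cancel_right1)
qed

lemma \<theta>0_nonneg: "\<theta>0 \<ge> 0"
  unfolding \<theta>0_def by (intro suminf_nonneg summable_theta0) (simp add: rate_nonneg)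

lemma theta1_term_nonneg: "real j * (real j - 1) * rate j \<ge> 0"
  using rate_nonneg[of j] by (cases "j = 0") auto

lemma \<theta>1_nonneg: "\<theta>1 \<ge> 0"
  unfolding \<theta>1_def by (intro suminf_nonneg summable_theta1 theta1_term_nonneg)

lemma norm_\<Lambda>_term_le: "norm z \<le> 1 \<Longrightarrow> norm (of_real (rate j) * z ^ j :: complex) \<le> rate j"
  using mult_left_mono[OF power_le_one[of "norm z" j] rate_nonneg[of j]]
  by (simp add: norm_mult norm_power rate_nonneg)

lemma norm_\<Lambda>'_term_le:
  "norm z \<le> 1 \<Longrightarrow> norm (of_real (real j * rate j) * z ^ (j - 1) :: complex) \<le> real j * rate j"
  using mult_left_mono[OF power_le_one[of "norm z" "j - 1"], of "real j * rate j"]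
  by (simp add: norm_mult norm_power rate_nonneg)

lemma continuous_on_\<Lambda>: "continuous_on (cball 0 1) \<Lambda>"
  unfolding \<Lambda>_def
  by (rule uniform_limit_theorem[OF _ Weierstrass_m_test[OF _ summable_rate]])
     (auto intro!: always_eventually continuous_intros simp: norm_\<Lambda>_term_le simp del: norm_mult)

lemma continuous_on_\<Lambda>': "continuous_on (cball 0 1) \<Lambda>'"
  unfolding \<Lambda>'_def
  by (rule uniform_limit_theorem[OF _ Weierstrass_m_test[OF _ summable_theta0]])
     (use norm_\<Lambda>'_term_le in \<open>auto intro!: always_eventually continuous_intros simp del: of_real_mult\<close>)

lemmas continuous_on_\<Lambda>_compose [continuous_intros] = continuous_on_compose2[OF continuous_on_\<Lambda>]
lemmas continuous_on_\<Lambda>'_compose [continuous_intros] = continuous_on_compose2[OF continuous_on_\<Lambda>']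

lemma summable_\<Lambda>': "norm z \<le> 1 \<Longrightarrow> summable (\<lambda>j. of_real (real j * rate j) * z ^ (j - 1) :: complex)"
  by (rule summable_comparison_test'[OF summable_theta0]) (rule norm_\<Lambda>'_term_le)

lemma summable_\<Lambda>: "norm z \<le> 1 \<Longrightarrow> summable (\<lambda>j. of_real (rate j) * z ^ j :: complex)"
  by (rule summable_comparison_test'[OF summable_rate]) (rule norm_\<Lambda>_term_le)

lemma has_field_derivative_\<Lambda>:
  assumes "norm z < 1"
  shows "(\<Lambda> has_field_derivative \<Lambda>' z) (at z)"
proof -
  have "((\<lambda>z. \<Sum>j. of_real (rate j) * z ^ j) has_field_derivative
          (\<Sum>j. diffs (\<lambda>j. of_real (rate j)) j * z ^ j)) (at z)"
    by (rule termdiffs_strong'[OF summable_\<Lambda> assms]) simp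
  also have "(\<Sum>j. diffs (\<lambda>j. of_real (rate j)) j * z ^ j) = \<Lambda>' z"
    unfolding \<Lambda>'_def
    using suminf_split_head[OF summable_\<Lambda>'[of z]] assms by (simp add: diffs_def)
  finally show ?thesis unfolding \<Lambda>_def .
qed

text \<open>The terms from index n on are dominated by the tail of the series for
  \<open>\<theta>0\<close>. The case n = 0 bounds \<open>\<Lambda>'\<close> itself; general n
  controls the truncated Stein equation uniformly in z.\<close>

lemma norm_\<Lambda>'_tail_le:
  assumes "norm z \<le> 1"
  shows "norm (\<Lambda>' z - (\<Sum>j<n. of_real (real j * rate j) * z ^ (j - 1))) \<le>
           \<theta>0 - (\<Sum>j<n. real j * rate j)"
proof -
  have "norm (\<Sum>j. of_real (real (j + n) * rate (j + n)) * z ^ (j + n - 1)) \<le>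
          (\<Sum>j. real (j + n) * rate (j + n))"
    by (rule norm_suminf_le[OF norm_\<Lambda>'_term_le[OF assms]
          summable_ignore_initial_segment[OF summable_theta0]])
  then show ?thesis
    using suminf_minus_initial_segment[OF summable_theta0, of n]
      suminf_minus_initial_segment[OF summable_\<Lambda>'[OF assms], of n]
    by (simp add: \<Lambda>'_def \<theta>0_def)
qed

lemma norm_\<Lambda>'_le: "norm z \<le> 1 \<Longrightarrow> norm (\<Lambda>' z) \<le> \<theta>0"
  using norm_\<Lambda>'_tail_le[of z 0] by simp

text \<open>Termwise, \<open>1 - z ^ (j - 1)\<close> is at most j - 1 times the distance from z to
  1, which produces the second factorial moment.\<close>

lemma norm_\<Lambda>'_minus_\<theta>0_le:
  assumes "norm z \<le> 1"
  shows "norm (\<theta>0 - \<Lambda>' z) \<le> \<theta>1 * norm (1 - z)"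
proof -
  have eq: "of_real \<theta>0 - \<Lambda>' z = (\<Sum>j. of_real (real j * rate j) * (1 - z ^ (j - 1)))"
    unfolding \<theta>0_def \<Lambda>'_def suminf_of_real[OF summable_theta0]
    by (subst suminf_diff[OF summable_of_real[OF summable_theta0] summable_\<Lambda>'[OF assms]])
       (simp add: algebra_simps)
  have "norm (\<Sum>j. of_real (real j * rate j) * (1 - z ^ (j - 1))) \<le>
          (\<Sum>j. real j * (real j - 1) * rate j * norm (1 - z))"
  proof (rule norm_suminf_le)
    fix j
    have "norm (of_real (real j * rate j) * (1 - z ^ (j - 1)))
        = real j * rate j * norm (1 - z ^ (j - 1))"
      by (simp add: norm_mult rate_nonneg)
    also have "\<dots> \<le> real j * rate j * (real (j - 1) * norm (1 - z))"
      by (intro mult_left_mono norm_one_minus_power_le assms) (simp add: rate_nonneg)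
    \<comment> \<open>Natural and real j - 1 differ only at j = 0, where the factor j kills both
      sides.\<close>
    also have "\<dots> = real j * (real j - 1) * rate j * norm (1 - z)"
      by (cases j) auto
    finally show "norm (of_real (real j * rate j) * (1 - z ^ (j - 1)))
                    \<le> real j * (real j - 1) * rate j * norm (1 - z)" .
  qed (intro summable_mult2 summable_theta1)
  then show ?thesis
    unfolding eq \<theta>1_def suminf_mult2[OF summable_theta1] .
qed

section \<open>Growth of the exponent along a chord\<close>

lemma has_vector_derivative_\<Lambda>_chord:
  assumes "0 < p" "p \<le> 1" "norm z < 1"
  shows "((\<lambda>p. \<Lambda> (chord z p)) has_vector_derivative - (1 - z) * \<Lambda>' (chord z p)) (at p)"
proof -
  have "(chord z has_vector_derivative - (1 - z)) (at p)"
    unfolding chord_def by (auto intro!: derivative_eq_intros)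
  from field_vector_diff_chain_at[OF this, of \<Lambda>] has_field_derivative_\<Lambda>[OF norm_chord_less[OF assms]]
  show ?thesis by (simp add: o_def)
qed

text \<open>The left side expands to \<open>1 - 2 * Re z + (norm z)\<^sup>2\<close>. This turns the
  second-order error into a multiple of \<open>Re (1 - z)\<close>, the factor that the linear term
  carries too.\<close>

lemma norm_one_minus_sq_le: "norm z \<le> 1 \<Longrightarrow> (norm (1 - z))\<^sup>2 \<le> 2 * Re (1 - z)" for z :: complex
proof -
  assume "norm z \<le> 1"
  then have "(norm z)\<^sup>2 \<le> 1" by (simp add: power_le_one)
  then show ?thesis
    unfolding cmod_power2 by (simp add: power2_eq_square algebra_simps)
qed

text \<open>Two pointwise bounds on the derivative of \<open>Re \<Lambda>\<close> along the chord
  are integrated from p to 1: \<open>Re \<Lambda>\<close> minus an explicit primitive of the bound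
  is nonincreasing. Derivatives are taken only at interior points, so p = 0 is allowed.\<close>

lemma Re_\<Lambda>_chord_diff_le:
  assumes p: "0 \<le> p" "p \<le> 1" and z: "norm z < 1"
  shows "Re (\<Lambda> z - \<Lambda> (chord z p)) \<le> Re (1 - z) * (1 - p) * (\<theta>1 * (1 + p) - \<theta>0)"
    and "Re (\<Lambda> z - \<Lambda> (chord z p)) \<le> 2 * \<theta>0"
proof -
  let ?\<phi> = "\<lambda>p. Re (\<Lambda> (chord z p))"
  let ?d = "\<lambda>p. Re (- (1 - z) * \<Lambda>' (chord z p))"
  have der: "(?\<phi> has_field_derivative ?d s) (at s)" if "p < s" "s < 1" for s
    using bounded_linear.has_vector_derivative[OF bounded_linear_Re has_vector_derivative_\<Lambda>_chord[of s z]]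
      that p z
    unfolding has_real_derivative_iff_has_vector_derivative by simp
  have le1: "norm (chord z s) \<le> 1" if "p \<le> s" "s \<le> 1" for s
    using that p z by (intro norm_chord_le) auto
  have cont: "continuous_on {p..1} ?\<phi>"
    using le1 by (intro continuous_intros) auto
  \<comment> \<open>Comparing \<open>\<Lambda>'\<close> with its value \<open>\<theta>0\<close> at 1
    isolates the drift \<open>- Re (1 - z) * \<theta>0\<close>; the rest is of second order in
    \<open>1 - z\<close>.\<close>
  have d1: "?d s \<le> Re (1 - z) * (2 * \<theta>1 * s - \<theta>0)" if s: "p < s" "s < 1" for s
  proof -
    have "?d s = Re ((1 - z) * (\<theta>0 - \<Lambda>' (chord z s))) - Re (1 - z) * \<theta>0"
      by (simp add: algebra_simps)
    also have "Re ((1 - z) * (\<theta>0 - \<Lambda>' (chord z s))) \<le> norm (1 - z) * norm (\<theta>0 - \<Lambda>' (chord z s))"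
      using complex_Re_le_cmod norm_mult by metis
    also have "\<dots> \<le> norm (1 - z) * (\<theta>1 * norm (1 - chord z s))"
      using s by (intro mult_left_mono norm_\<Lambda>'_minus_\<theta>0_le le1) auto
    also have "\<dots> = \<theta>1 * s * (norm (1 - z))\<^sup>2"
      using s p by (simp add: chord_def norm_mult power2_eq_square)
    also have "\<dots> \<le> \<theta>1 * s * (2 * Re (1 - z))"
      using s p z \<theta>1_nonneg by (intro mult_left_mono norm_one_minus_sq_le) auto
    finally show ?thesis by (simp add: algebra_simps)
  qed
  have d2: "?d s \<le> 2 * \<theta>0" if s: "p < s" "s < 1" for s
  proof -
    have "?d s \<le> norm (- (1 - z)) * norm (\<Lambda>' (chord z s))"
      using complex_Re_le_cmod norm_mult by metis
    also have "\<dots> \<le> 2 * \<theta>0"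
      using z s norm_triangle_ineq4[of 1 z] \<theta>0_nonneg
      by (intro mult_mono norm_\<Lambda>'_le le1) (auto simp: norm_minus_commute)
    finally show ?thesis .
  qed
  have "?\<phi> 1 - Re (1 - z) * (\<theta>1 * 1\<^sup>2 - \<theta>0 * 1) \<le> ?\<phi> p - Re (1 - z) * (\<theta>1 * p\<^sup>2 - \<theta>0 * p)"
  proof (rule DERIV_nonpos_imp_decreasing_open[OF p(2)])
    fix s assume s: "p < s" "s < 1"
    have "((\<lambda>p. ?\<phi> p - Re (1 - z) * (\<theta>1 * p\<^sup>2 - \<theta>0 * p)) has_field_derivative
            ?d s - Re (1 - z) * (2 * \<theta>1 * s - \<theta>0)) (at s)"
      by (rule DERIV_diff[OF der[OF s]]) (auto intro!: derivative_eq_intros)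
    then show "\<exists>y. ((\<lambda>p. ?\<phi> p - Re (1 - z) * (\<theta>1 * p\<^sup>2 - \<theta>0 * p)) has_field_derivative y) (at s) \<and> y \<le> 0"
      using d1[OF s] by (intro exI conjI) (assumption, simp only: diff_le_0_iff_le)
  qed (intro continuous_intros cont)
  then show "Re (\<Lambda> z - \<Lambda> (chord z p)) \<le> Re (1 - z) * (1 - p) * (\<theta>1 * (1 + p) - \<theta>0)"
    by (simp add: algebra_simps power2_eq_square)
  have "?\<phi> 1 - 2 * \<theta>0 * 1 \<le> ?\<phi> p - 2 * \<theta>0 * p"
  proof (rule DERIV_nonpos_imp_decreasing_open[OF p(2)])
    fix s assume s: "p < s" "s < 1"
    have "((\<lambda>p. ?\<phi> p - 2 * \<theta>0 * p) has_field_derivative ?d s - 2 * \<theta>0) (at s)"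
      by (rule DERIV_diff[OF der[OF s]]) (auto intro!: derivative_eq_intros)
    then show "\<exists>y. ((\<lambda>p. ?\<phi> p - 2 * \<theta>0 * p) has_field_derivative y) (at s) \<and> y \<le> 0"
      using d2[OF s] by (intro exI conjI) (assumption, simp only: diff_le_0_iff_le)
  qed (intro continuous_intros cont)
  moreover have "\<theta>0 * p \<ge> 0" using p \<theta>0_nonneg by simp
  ultimately show "Re (\<Lambda> z - \<Lambda> (chord z p)) \<le> 2 * \<theta>0"
    by simp
qed

lemma Re_\<Lambda>_chord_diff_le_excess:
  assumes p: "0 \<le> p" "p \<le> 1" and z: "norm z < 1" and D: "2 * \<theta>1 - \<theta>0 > 0"
  shows "Re (\<Lambda> z - \<Lambda> (chord z p)) \<le> 0.74 * (2 * \<theta>1 - \<theta>0)"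
  \<comment> \<open>The two bounds on the exponent cross at \<open>\<theta>\<^sub>0 = (sqrt 3 - 1) / 2 * D\<close>, where both equal
    \<open>(sqrt 3 - 1) * D\<close>; \<open>0.37\<close> and \<open>0.74\<close> round these up.\<close>
proof (cases "\<theta>0 \<le> 0.37 * (2 * \<theta>1 - \<theta>0)")
  case True
  then show ?thesis using Re_\<Lambda>_chord_diff_le(2)[OF p z] by linarith
next
  case False
  define D where "D = 2 * \<theta>1 - \<theta>0"
  have D_pos: "D > 0" and \<theta>1: "2 * \<theta>1 \<ge> 1.37 * D"
    using False assms(4) by (simp_all add: D_def)
  \<comment> \<open>With q = 1 - p the bracket \<open>\<theta>1 * (1 + p) - \<theta>0\<close>
    becomes \<open>D - \<theta>1 * q\<close>. Completing the square in q bounds E, and 1.37 * 0.74 >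
    1 gives the constant.\<close>
  define q where "q = 1 - p"
  define E where "E = q * (D - \<theta>1 * q)"
  have a: "0 \<le> Re (1 - z)" "Re (1 - z) \<le> 2"
    using z abs_Re_le_cmod[of z] by auto
  have "2 * \<theta>1 * (2 * E) = D\<^sup>2 - (D - 2 * \<theta>1 * q)\<^sup>2"
    by (simp add: E_def power2_eq_square algebra_simps)
  also have "\<dots> \<le> D\<^sup>2" by simp
  also have "\<dots> \<le> 2 * \<theta>1 * (0.74 * D)"
    using mult_right_mono[OF \<theta>1, of "0.74 * D"] D_pos by (simp add: power2_eq_square)
  finally have "2 * E \<le> 0.74 * D"
    using \<theta>1 D_pos by (subst (asm) mult_le_cancel_left_pos) auto
  \<comment> \<open>Replacing \<open>Re (1 - z)\<close> by 2 is valid for E \<ge> 0; for negative E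
    the product is nonpositive.\<close>
  then have "Re (1 - z) * E \<le> 0.74 * D"
    using a D_pos mult_right_mono[OF a(2), of E] mult_nonneg_nonpos[OF a(1), of E]
    by (cases "E \<ge> 0") auto
  moreover have "Re (1 - z) * (1 - p) * (\<theta>1 * (1 + p) - \<theta>0) = Re (1 - z) * E"
    by (simp add: E_def q_def D_def algebra_simps)
  ultimately show ?thesis
    using Re_\<Lambda>_chord_diff_le(1)[OF p z] unfolding D_def[symmetric] by linarith
qed

subsection \<open>Generating functions of Stein solutions\<close>

text \<open>At x = 0 the truncated exponent x - 1 yields a default value; the Stein equation only
  meets it with the factor x = 0 or the weight of j = 0.\<close>

definition stein_kernel :: "nat \<Rightarrow> complex \<Rightarrow> real \<Rightarrow> complex" where
  "stein_kernel x z p = chord z p ^ (x - 1) * exp (\<Lambda> z - \<Lambda> (chord z p))"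

definition stein_gf :: "nat \<Rightarrow> complex \<Rightarrow> complex" where
  "stein_gf x z = integral {0..1} (stein_kernel x z)"

lemma continuous_on_exp_\<Lambda>_chord:
  "norm z \<le> 1 \<Longrightarrow> continuous_on {0..1} (\<lambda>p. exp (\<Lambda> z - \<Lambda> (chord z p)))"
  using norm_chord_le by (intro continuous_intros) auto

lemma continuous_on_stein_kernel:
  "norm z \<le> 1 \<Longrightarrow> continuous_on {0..1} (stein_kernel x z)"
  unfolding stein_kernel_def by (intro continuous_intros continuous_on_exp_\<Lambda>_chord)

lemma stein_kernel_integrable: "norm z \<le> 1 \<Longrightarrow> stein_kernel x z integrable_on {0..1}"
  by (intro integrable_continuous_interval continuous_on_stein_kernel)

text \<open>Differentiation under the integral sign. The z-derivative of the kernel is jointly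
  continuous down to p = 0 because \<open>\<Lambda>'\<close> is continuous on the closed
  disc.\<close>

lemma holomorphic_on_stein_gf: "stein_gf x holomorphic_on ball 0 1"
proof -
  let ?dw = "\<lambda>z p. of_nat (x - 1) * chord z p ^ (x - 1 - 1) * of_real p"
  let ?e = "\<lambda>z p. exp (\<Lambda> z - \<Lambda> (chord z p))"
  let ?d = "\<lambda>z p. ?dw z p * ?e z p
                + chord z p ^ (x - 1) * (?e z p * (\<Lambda>' z - \<Lambda>' (chord z p) * of_real p))"
  have "(\<lambda>z. integral (cbox 0 1) (stein_kernel x z)) holomorphic_on ball 0 1"
  proof (rule leibniz_rule_holomorphic[where fx = ?d])
    fix z :: complex and p :: real
    assume z: "z \<in> ball 0 1" and "p \<in> cbox 0 1"
    then have p: "0 \<le> p" "p \<le> 1" and z1: "norm z < 1" by auto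
    have dc: "((\<lambda>z. chord z p) has_field_derivative of_real p) (at z)"
      unfolding chord_def by (auto intro!: derivative_eq_intros)
    \<comment> \<open>At p = 0 the point is 1 whatever z is, so the map is constant there and no
      derivative of \<open>\<Lambda>\<close> at 1 is required.\<close>
    have dL: "((\<lambda>z. \<Lambda> (chord z p)) has_field_derivative \<Lambda>' (chord z p) * of_real p) (at z)"
    proof (cases "p = 0")
      case False
      then show ?thesis
        using DERIV_chain2[OF has_field_derivative_\<Lambda>[OF norm_chord_less] dc] p z1 by simp
    qed (simp add: chord_def)
    show "((\<lambda>z. stein_kernel x z p) has_field_derivative ?d z p) (at z within ball 0 1)"
      unfolding stein_kernel_def
      by (rule DERIV_subset[of _ _ _ UNIV])
         (auto intro!: derivative_eq_intros dc dL has_field_derivative_\<Lambda>[OF z1] simp: algebra_simps)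
  next
    have le1: "norm (chord z p) \<le> 1" if "z \<in> ball 0 1" "p \<in> {0..1}" for z p
      using that by (intro norm_chord_le) auto
    show "continuous_on (ball 0 1 \<times> cbox 0 1) (\<lambda>(z, p). ?d z p)"
      unfolding case_prod_unfold using le1
      by (intro continuous_intros) (auto simp: mem_Times_iff)
  qed (auto intro: stein_kernel_integrable)
  then show ?thesis
    unfolding stein_gf_def by simp
qed

lemma norm_exp_\<Lambda>_chord_le:
  assumes "0 \<le> p" "p \<le> 1" "norm z < 1" "2 * \<theta>1 - \<theta>0 > 0"
  shows "norm (exp (\<Lambda> z - \<Lambda> (chord z p))) \<le> exp (0.74 * (2 * \<theta>1 - \<theta>0))"
  using Re_\<Lambda>_chord_diff_le_excess[OF assms] by simp

lemma norm_stein_gf_le: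
  assumes z: "norm z < 1" and D: "2 * \<theta>1 - \<theta>0 > 0"
  shows "norm (stein_gf x z) \<le> exp (0.74 * (2 * \<theta>1 - \<theta>0))"
proof -
  have "norm (integral {0..1} (stein_kernel x z)) \<le> exp (0.74 * (2 * \<theta>1 - \<theta>0)) * (1 - 0)"
  proof (rule integral_bound)
    fix p :: real assume p: "p \<in> {0..1}"
    have "norm (stein_kernel x z p) \<le> 1 * exp (0.74 * (2 * \<theta>1 - \<theta>0))"
      unfolding stein_kernel_def norm_mult norm_power
      using p z D by (intro mult_mono power_le_one norm_chord_le norm_exp_\<Lambda>_chord_le) auto
    then show "norm (stein_kernel x z p) \<le> exp (0.74 * (2 * \<theta>1 - \<theta>0))" by simp
  qed (use z in \<open>auto intro: continuous_on_stein_kernel\<close>)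
  then show ?thesis by (simp add: stein_gf_def)
qed

section \<open>The Stein equation for generating functions and its coefficients\<close>

text \<open>The primitive is \<open>?G\<close>. Its values at p = 1 and p = 0 give the two terms on
  the right, and \<open>exp (\<Lambda> z - \<Lambda> 1)\<close> will be the probability generating
  function of U.\<close>

lemma has_integral_stein_equation:
  assumes z: "norm z < 1"
  shows "((\<lambda>p. (chord z p ^ x * \<Lambda>' (chord z p) - of_nat x * chord z p ^ (x - 1))
             * exp (\<Lambda> z - \<Lambda> (chord z p))) has_integral
          (z ^ x - exp (\<Lambda> z - \<Lambda> 1)) / (1 - z)) {0..1}"
proof -
  have "z \<noteq> 1" using z by auto
  let ?G = "\<lambda>p. chord z p ^ x * exp (\<Lambda> z - \<Lambda> (chord z p)) / (1 - z)"
  have "((\<lambda>p. (chord z p ^ x * \<Lambda>' (chord z p) - of_nat x * chord z p ^ (x - 1))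
             * exp (\<Lambda> z - \<Lambda> (chord z p))) has_integral ?G 1 - ?G 0) {0..1}"
  proof (rule fundamental_theorem_of_calculus_interior)
    fix p :: real assume p: "p \<in> {0<..<1}"
    have dc: "(chord z has_vector_derivative - (1 - z)) (at p)"
      unfolding chord_def by (auto intro!: derivative_eq_intros)
    have dL: "((\<lambda>p. \<Lambda> (chord z p)) has_vector_derivative - (1 - z) * \<Lambda>' (chord z p)) (at p)"
      using p z by (intro has_vector_derivative_\<Lambda>_chord) auto
    have dw: "((\<lambda>p. chord z p ^ x) has_vector_derivative - (1 - z) * (of_nat x * chord z p ^ (x - 1))) (at p)"
    proof -
      have "((\<lambda>w. w ^ x) has_field_derivative of_nat x * w ^ (x - 1)) (at w)" for w :: complex
        by (auto intro!: derivative_eq_intros)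
      from field_vector_diff_chain_at[OF dc this] show ?thesis by (simp add: o_def)
    qed
    have de: "((\<lambda>p. exp (\<Lambda> z - \<Lambda> (chord z p))) has_vector_derivative
           ((1 - z) * \<Lambda>' (chord z p)) * exp (\<Lambda> z - \<Lambda> (chord z p))) (at p)"
      using field_vector_diff_chain_at[OF has_vector_derivative_diff[OF has_vector_derivative_const dL] DERIV_exp, of "\<Lambda> z"]
      by (simp add: o_def algebra_simps)
    show "(?G has_vector_derivative (chord z p ^ x * \<Lambda>' (chord z p) - of_nat x * chord z p ^ (x - 1))
             * exp (\<Lambda> z - \<Lambda> (chord z p))) (at p)"
      using \<open>z \<noteq> 1\<close>
      by (intro has_vector_derivative_eq_rhs[OF
            has_vector_derivative_divide[OF has_vector_derivative_mult[OF dw de], of "1 - z"]])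
         (simp add: divide_simps, simp add: algebra_simps)
  qed (use z \<open>z \<noteq> 1\<close> in \<open>auto intro!: continuous_intros continuous_on_exp_\<Lambda>_chord\<close>)
  then show ?thesis by (simp add: diff_divide_distrib)
qed

text \<open>Truncating the sum at n leaves the integral of a tail of \<open>\<Lambda>'\<close>
  against bounded factors. The bound does not depend on z, so Cauchy's inequality can pass it on to
  the coefficients.\<close>

lemma norm_stein_gf_residual_le:
  assumes z: "norm z < 1" and D: "2 * \<theta>1 - \<theta>0 > 0"
  shows "norm ((z ^ x - exp (\<Lambda> z - \<Lambda> 1)) / (1 - z)
           - ((\<Sum>j<n. of_real (real j * rate j) * stein_gf (x + j) z) - of_nat x * stein_gf x z))
         \<le> exp (0.74 * (2 * \<theta>1 - \<theta>0)) * (\<theta>0 - (\<Sum>j<n. real j * rate j))"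
proof -
  let ?e = "\<lambda>p. exp (\<Lambda> z - \<Lambda> (chord z p))" and ?w = "chord z"
  let ?B = "exp (0.74 * (2 * \<theta>1 - \<theta>0)) * (\<theta>0 - (\<Sum>j<n. real j * rate j))"
  let ?S = "\<lambda>p. \<Sum>j<n. of_real (real j * rate j) * stein_kernel (x + j) z p"
  let ?R = "\<lambda>p. (?w p ^ x * \<Lambda>' (?w p) - of_nat x * ?w p ^ (x - 1)) * ?e p
                - (?S p - of_nat x * stein_kernel x z p)"
  have gf: "(stein_kernel y z has_integral stein_gf y z) {0..1}" for y
    unfolding stein_gf_def using z by (intro integrable_integral stein_kernel_integrable) simp
  have int: "(?R has_integral (z ^ x - exp (\<Lambda> z - \<Lambda> 1)) / (1 - z)
           - ((\<Sum>j<n. of_real (real j * rate j) * stein_gf (x + j) z) - of_nat x * stein_gf x z)) {0..1}"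
    by (intro has_integral_diff has_integral_sum has_integral_mult_right gf has_integral_stein_equation z) simp
  have eq: "?R p = ?w p ^ x * (\<Lambda>' (?w p) - (\<Sum>j<n. of_real (real j * rate j) * ?w p ^ (j - 1))) * ?e p" for p
  proof -
    \<comment> \<open>For j > 0 the exponent x + j - 1 splits as x + (j - 1); for j = 0 the weight
      is zero.\<close>
    have "of_real (real j * rate j) * stein_kernel (x + j) z p =
            ?w p ^ x * (of_real (real j * rate j) * ?w p ^ (j - 1)) * ?e p" for j
      by (cases j) (simp_all add: stein_kernel_def power_add)
    then have "?S p = ?w p ^ x * (\<Sum>j<n. of_real (real j * rate j) * ?w p ^ (j - 1)) * ?e p"
      by (simp only: sum_distrib_left sum_distrib_right)
    then show ?thesis
      by (simp add: stein_kernel_def algebra_simps)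
  qed
  have bound: "norm (?R p) \<le> ?B" if p: "p \<in> cbox 0 1" for p
  proof -
    have le1: "norm (?w p) \<le> 1" using p z by (intro norm_chord_le) auto
    have "norm (?R p) \<le> 1 * (\<theta>0 - (\<Sum>j<n. real j * rate j)) * exp (0.74 * (2 * \<theta>1 - \<theta>0))"
      unfolding eq norm_mult norm_power using p z D le1 order_trans[OF norm_ge_zero norm_\<Lambda>'_tail_le[OF le1]]
      by (intro mult_mono power_le_one norm_\<Lambda>'_tail_le norm_exp_\<Lambda>_chord_le) auto
    then show ?thesis by (simp add: mult.commute)
  qed
  have "0 \<le> ?B"
    using norm_ge_zero[THEN order_trans, OF norm_\<Lambda>'_tail_le[of 0 n]] by simp
  from has_integral_bound[OF this int[folded cbox_interval] bound] show ?thesis by simp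
qed

abbreviation stein_coeff :: "nat \<Rightarrow> nat \<Rightarrow> complex" where
  "stein_coeff y x \<equiv> fps_nth (fps_expansion (stein_gf x) 0) y"

lemma norm_stein_coeff_le:
  "2 * \<theta>1 - \<theta>0 > 0 \<Longrightarrow> norm (stein_coeff y x) \<le> exp (0.74 * (2 * \<theta>1 - \<theta>0))"
  by (intro norm_fps_expansion_nth_le holomorphic_on_stein_gf norm_stein_gf_le)

text \<open>Each coefficient of the truncation error \<open>G n\<close> is at most the uniform bound
  on \<open>G n\<close>, which tends to 0 with the tail of \<open>\<theta>0\<close>. Hence taking
  coefficients commutes with the infinite sum.\<close>

lemma stein_coeff_sums:
  assumes D: "2 * \<theta>1 - \<theta>0 > 0"
    and r: "(\<lambda>z. (z ^ x - exp (\<Lambda> z - \<Lambda> 1)) / (1 - z)) has_fps_expansion r"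
  shows "(\<lambda>j. of_real (real j * rate j) * stein_coeff y (x + j)) sums
           (fps_nth r y + of_nat x * stein_coeff y x)"
proof -
  let ?B = "exp (0.74 * (2 * \<theta>1 - \<theta>0))"
  define G where "G = (\<lambda>n z. (z ^ x - exp (\<Lambda> z - \<Lambda> 1)) / (1 - z)
      - ((\<Sum>j<n. of_real (real j * rate j) * stein_gf (x + j) z) - of_nat x * stein_gf x z))"
  let ?c = "\<lambda>n. fps_nth r y - ((\<Sum>j<n. of_real (real j * rate j) * stein_coeff y (x + j))
                                 - of_nat x * stein_coeff y x)"
  have bound: "norm (?c n) \<le> ?B * (\<theta>0 - (\<Sum>j<n. real j * rate j))" for n
  proof -
    have gf: "stein_gf k has_fps_expansion fps_expansion (stein_gf k) 0" for k
      by (rule has_fps_expansion_fps_expansion[OF _ _ holomorphic_on_stein_gf]) auto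
    have "G n has_fps_expansion r - ((\<Sum>j<n. fps_const (of_real (real j * rate j)) * fps_expansion (stein_gf (x + j)) 0)
             - fps_const (of_nat x) * fps_expansion (stein_gf x) 0)"
      unfolding G_def
      by (intro has_fps_expansion_diff has_fps_expansion_sum has_fps_expansion_cmult_left r gf)
    from fps_nth_fps_expansion[OF this, of y] have "?c n = fps_nth (fps_expansion (G n) 0) y"
      by (simp add: fps_expansion_def fps_sum_nth)
    also have "norm \<dots> \<le> ?B * (\<theta>0 - (\<Sum>j<n. real j * rate j))"
    proof (rule norm_fps_expansion_nth_le)
      have "\<Lambda> holomorphic_on ball 0 1"
        by (subst holomorphic_on_open) (auto intro!: exI has_field_derivative_\<Lambda>)
      then show "G n holomorphic_on ball 0 1"
        unfolding G_def by (intro holomorphic_intros holomorphic_on_stein_gf) auto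
      show "norm (G n z) \<le> ?B * (\<theta>0 - (\<Sum>j<n. real j * rate j))" if "norm z < 1" for z
        unfolding G_def by (rule norm_stein_gf_residual_le[OF that D])
    qed
    finally show ?thesis .
  qed
  have "(\<lambda>n. ?B * (\<theta>0 - (\<Sum>j<n. real j * rate j))) \<longlonglongrightarrow> ?B * (\<theta>0 - \<theta>0)"
    unfolding \<theta>0_def by (intro tendsto_intros summable_LIMSEQ summable_theta0)
  then have null: "(\<lambda>n. ?B * (\<theta>0 - (\<Sum>j<n. real j * rate j))) \<longlonglongrightarrow> 0"
    by (simp only: diff_self mult_zero_right)
  have "?c \<longlonglongrightarrow> 0"
    by (rule Lim_null_comparison[OF _ null], rule always_eventually, rule allI, rule bound)
  from tendsto_diff[OF tendsto_const[of "fps_nth r y + of_nat x * stein_coeff y x"] this]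
  show ?thesis unfolding sums_def by simp
qed

end

subsection \<open>The compound Poisson distribution\<close>

text \<open>Split into real and imaginary parts, each a bounded real integrand; boundedness makes
  every integral exist.\<close>

lemma integral_bind_pmf_complex:
  fixes f :: "'b \<Rightarrow> complex"
  assumes f: "\<And>x. norm (f x) \<le> B"
  shows "(\<integral>x. f x \<partial>bind_pmf M N) = (\<integral>x. \<integral>y. f y \<partial>N x \<partial>M)"
proof -
  have bind: "(\<integral>x. g x \<partial>bind_pmf M N) = (\<integral>x. \<integral>y. g y \<partial>N x \<partial>M)"
    if "\<And>x. \<bar>g x\<bar> \<le> B" for g :: "'b \<Rightarrow> real"
    unfolding measure_pmf_bind
    by (rule integral_bind[where K = "count_space UNIV" and B = B and B' = 1])
       (use that in \<open>auto simp: measurable_def space_subprob_algebra measure_pmf.subprob_space_axioms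
         measure_pmf.finite_measure_axioms measure_pmf.emeasure_space_1\<close>)
  have int: "integrable (measure_pmf q) f" for q
    by (rule measure_pmf.integrable_const_bound[where B = B]) (use f in auto)
  have "norm (\<integral>y. f y \<partial>N x) \<le> B" for x
    by (rule order_trans[OF integral_norm_bound measure_pmf.integral_le_const])
       (use f int in auto)
  then have int2: "integrable (measure_pmf M) (\<lambda>x. \<integral>y. f y \<partial>N x)"
    by (intro measure_pmf.integrable_const_bound[where B = B]) auto
  have "\<bar>Re (f x)\<bar> \<le> B" "\<bar>Im (f x)\<bar> \<le> B" for x
    using f order_trans abs_Re_le_cmod abs_Im_le_cmod by blast+
  from bind[OF this(1)] bind[OF this(2)] show ?thesis
    by (simp add: complex_eq_iff int int2 flip: integral_Re integral_Im)
qed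

lemma pmf_nat_expectation_sums:
  fixes f :: "nat \<Rightarrow> complex"
  assumes "\<And>k. norm (f k) \<le> B"
  shows "(\<lambda>k. of_real (pmf p k) * f k) sums measure_pmf.expectation p f"
proof -
  have "integrable (measure_pmf p) f"
    by (rule measure_pmf.integrable_const_bound[where B = B]) (use assms in auto)
  then have "integrable (count_space UNIV) (\<lambda>k. pmf p k *\<^sub>R f k)"
    unfolding measure_pmf_eq_density by (subst (asm) integrable_density) auto
  from sums_integral_count_space_nat[OF this] show ?thesis
    unfolding measure_pmf_eq_density by (subst integral_density) (auto simp: scaleR_conv_of_real)
qed

lemma replicate_pmf_pgf:
  fixes z :: complex
  assumes z: "norm z \<le> 1"
  shows "measure_pmf.expectation (replicate_pmf n p) (\<lambda>xs. z ^ sum_list xs) =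
           measure_pmf.expectation p (\<lambda>k. z ^ k) ^ n"
proof (induction n)
  case (Suc n)
  have "norm (z ^ k) \<le> 1" for k using z by (simp add: norm_power power_le_one)
  then show ?case
    by (simp add: integral_bind_pmf_complex[where B = 1] power_add Suc)
qed simp

text \<open>Given N = n the generating function is the n-th power of that of \<open>mu\<close>;
  averaging over the Poisson weights sums an exponential series.\<close>

lemma compound_poisson_pgf:
  fixes z :: complex
  assumes lam: "lam > 0" and z: "norm z \<le> 1"
  shows "measure_pmf.expectation (compound_poisson_pmf lam mu) (\<lambda>k. z ^ k) =
           exp (of_real lam * measure_pmf.expectation mu (\<lambda>k. z ^ k) - of_real lam)"
proof -
  let ?m = "measure_pmf.expectation mu (\<lambda>k. z ^ k)"
  have zk: "norm (z ^ k) \<le> 1" for k using z by (simp add: norm_power power_le_one)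
  have "norm ?m \<le> 1"
    by (rule order_trans[OF integral_norm_bound measure_pmf.integral_le_const])
       (use zk in \<open>auto intro: measure_pmf.integrable_const_bound[where B = 1]\<close>)
  then have mn: "norm (?m ^ n) \<le> 1" for n by (simp add: norm_power power_le_one)
  have "measure_pmf.expectation (compound_poisson_pmf lam mu) (\<lambda>k. z ^ k) =
          measure_pmf.expectation (poisson_pmf lam) (\<lambda>n. ?m ^ n)"
    unfolding compound_poisson_pmf_def
    by (simp add: integral_bind_pmf_complex[where B = 1] zk replicate_pmf_pgf[OF z])
  moreover have "(\<lambda>n. of_real (pmf (poisson_pmf lam) n) * ?m ^ n) sums
          measure_pmf.expectation (poisson_pmf lam) (\<lambda>n. ?m ^ n)"
    by (rule pmf_nat_expectation_sums[OF mn])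
  moreover have "(\<lambda>n. exp (- of_real lam) * ((of_real lam * ?m) ^ n /\<^sub>R fact n)) sums
          (exp (- of_real lam) * exp (of_real lam * ?m))"
    by (intro sums_mult exp_converges)
  then have "(\<lambda>n. of_real (pmf (poisson_pmf lam) n) * ?m ^ n) sums
          (exp (- of_real lam) * exp (of_real lam * ?m))"
    using lam by (simp add: power_mult_distrib scaleR_conv_of_real divide_simps exp_of_real[symmetric] mult_ac)
  ultimately show ?thesis
    by (auto simp: sums_iff exp_add[symmetric] algebra_simps)
qed

text \<open>Division by 1 - z forms partial sums of coefficients, turning point masses into
  distribution functions.\<close>

lemma cdf_gf_has_fps_expansion:
  fixes q :: "nat pmf"
  shows "(\<lambda>z. (z ^ x - measure_pmf.expectation q (\<lambda>k. z ^ k)) / (1 - z)) has_fps_expansion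
           Abs_fps (\<lambda>y. of_real (indicator {..y} x - measure_pmf.expectation q (indicator {..y})) :: complex)"
proof -
  let ?Q = "Abs_fps (\<lambda>k. of_real (pmf q k) :: complex)"
  have sums: "(\<lambda>k. of_real (pmf q k) * z ^ k) sums measure_pmf.expectation q (\<lambda>k. z ^ k)"
    if "norm z < 1" for z :: complex
    using that by (intro pmf_nat_expectation_sums[where B = 1]) (simp add: norm_power power_le_one)
  have "(\<lambda>z. measure_pmf.expectation q (\<lambda>k. z ^ k)) has_fps_expansion ?Q"
    by (rule has_fps_expansionI[OF eventually_mono[OF eventually_nhds_in_open[of "ball 0 1"]]])
       (use sums in auto)
  then have "(\<lambda>z. (z ^ x - measure_pmf.expectation q (\<lambda>k. z ^ k)) * inverse (1 - z)) has_fps_expansion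
           (fps_X ^ x - ?Q) * inverse (1 - fps_X)"
    by (intro fps_expansion_intros) auto
  also have "(fps_X ^ x - ?Q) * inverse (1 - fps_X) =
    Abs_fps (\<lambda>y. of_real (indicator {..y} x - measure_pmf.expectation q (indicator {..y})))"
  proof (rule fps_ext)
    fix y
    have "(\<Sum>i=0..y. if i = x then 1 else 0 :: complex) = indicator {..y} x"
      by (simp add: indicator_def)
    moreover have "measure_pmf.expectation q (indicator {..y}) = (\<Sum>i=0..y. pmf q i)"
      by (simp add: measure_measure_pmf_finite atLeast0AtMost)
    ultimately show "fps_nth ((fps_X ^ x - ?Q) * inverse (1 - fps_X)) y =
      fps_nth (Abs_fps (\<lambda>y. of_real (indicator {..y} x - measure_pmf.expectation q (indicator {..y})))) y"
      by (simp add: fps_inverse_one_minus_fps_X fps_mult_nth sum_subtractf fps_X_power_nth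
           of_real_indicator)
  qed
  finally show ?thesis by (simp add: divide_inverse)
qed

subsection \<open>Uniqueness and the Stein factors\<close>

text \<open>The difference d of two bounded solutions satisfies
  \<open>x * d x = (sum of a j * d (x + j))\<close>, which involves only larger arguments on the
  right. Far out this is a contraction, so d vanishes there; descending from there gives d = 0 at
  every x \<ge> 1.\<close>

lemma bounded_stein_solution_unique:
  assumes lam: "lam > 0"
    and sum1: "(\<lambda>j. real j * cp_rate lam mu j) summable_on {1..}"
    and f: "bounded_stein_solution lam mu h f" and g: "bounded_stein_solution lam mu h g"
    and x: "x \<ge> 1"
  shows "f x = g x"
proof -
  define a where "a = (\<lambda>j. real j * cp_rate lam mu j)"
  define d where "d = (\<lambda>x. f x - g x)"
  have a_nonneg: "a j \<ge> 0" for j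
    using lam by (simp add: a_def cp_rate_def)
  define t where "t = infsum a {1..}"
  have t: "t \<ge> 0" unfolding t_def by (intro infsum_nonneg a_nonneg)
  obtain A where A: "\<And>x. x \<ge> 1 \<Longrightarrow> norm (f x) \<le> A"
    using f unfolding bounded_stein_solution_def bounded_iff by auto
  obtain B where B: "\<And>x. x \<ge> 1 \<Longrightarrow> norm (g x) \<le> B"
    using g unfolding bounded_stein_solution_def bounded_iff by auto
  have asum: "a summable_on {1..}" using sum1 by (simp add: a_def)
  have summ: "(\<lambda>j. norm (a j * u (x + j))) summable_on {1..}"
    if "\<And>x. x \<ge> 1 \<Longrightarrow> norm (u x) \<le> C" for u :: "nat \<Rightarrow> real" and C x
  proof (rule summable_on_comparison_test)
    show "(\<lambda>j. a j * C) summable_on {1..}"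
      by (rule summable_on_cmult_left) (rule asum)
    show "norm (a j * u (x + j)) \<le> a j * C" if "j \<in> {1..}" for j
      using that \<open>\<And>x. x \<ge> 1 \<Longrightarrow> norm (u x) \<le> C\<close>[of "x + j"] a_nonneg[of j]
      by (auto simp: abs_mult intro!: mult_left_mono)
  qed auto
  have bd: "norm (d x) \<le> A + B" if "x \<ge> 1" for x
    using A[OF that] B[OF that] by (simp add: d_def)
  have hom: "real x * d x = (\<Sum>\<^sub>\<infinity>j\<in>{1..}. a j * d (x + j))" for x
  proof -
    have "h x - measure_pmf.expectation (compound_poisson_pmf lam mu) h =
            (\<Sum>\<^sub>\<infinity>j\<in>{1..}. a j * f (x + j)) - real x * f x"
      using f unfolding bounded_stein_solution_def a_def by blast
    moreover have "h x - measure_pmf.expectation (compound_poisson_pmf lam mu) h =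
            (\<Sum>\<^sub>\<infinity>j\<in>{1..}. a j * g (x + j)) - real x * g x"
      using g unfolding bounded_stein_solution_def a_def by blast
    moreover have "(\<lambda>j. a j * f (x + j)) summable_on {1..}"
      by (rule abs_summable_summable[OF summ[OF A]])
    moreover have "(\<lambda>j. a j * g (x + j)) summable_on {1..}"
      by (rule abs_summable_summable[OF summ[OF B]])
    ultimately show ?thesis
      using infsum_add[of "\<lambda>j. a j * f (x + j)" "{1..}" "\<lambda>j. - (a j * g (x + j))"]
      by (simp add: d_def right_diff_distrib infsum_uminus summable_on_uminus)
  qed
  have step: "real x * norm (d x) \<le> t * C" if "\<And>y. y > x \<Longrightarrow> norm (d y) \<le> C" for x C
  proof -
    have "real x * norm (d x) = norm (\<Sum>\<^sub>\<infinity>j\<in>{1..}. a j * d (x + j))"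
      unfolding hom[of x, symmetric] by (simp add: abs_mult)
    also have "\<dots> \<le> (\<Sum>\<^sub>\<infinity>j\<in>{1..}. norm (a j * d (x + j)))"
      by (rule norm_infsum_bound[OF summ[OF bd]])
    also have "\<dots> \<le> (\<Sum>\<^sub>\<infinity>j\<in>{1..}. a j * C)"
      using that a_nonneg
      by (intro infsum_mono summ[OF bd] summable_on_cmult_left asum) (auto simp: abs_mult intro!: mult_left_mono)
    also have "\<dots> = t * C"
      unfolding t_def by (rule infsum_cmult_left) (use asum in simp)
    finally show ?thesis .
  qed
  \<comment> \<open>For x \<ge> t + 1, dividing \<open>step\<close> by x shrinks any bound valid
    beyond x by at least this factor.\<close>
  define \<rho> where "\<rho> = t / (t + 1)"
  have \<rho>: "0 \<le> \<rho>" "\<rho> < 1" using t by (auto simp: \<rho>_def)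
  have geo: "norm (d x) \<le> (A + B) * \<rho> ^ n" if "x \<ge> t + 1" for x n
    using that
  proof (induction n arbitrary: x)
    case 0
    then show ?case using bd[of x] t by simp
  next
    case (Suc n)
    have "(t + 1) * norm (d x) \<le> real x * norm (d x)"
      using Suc.prems by (intro mult_right_mono) auto
    also have "\<dots> \<le> t * ((A + B) * \<rho> ^ n)"
      using Suc.prems by (intro step Suc.IH) auto
    also have "\<dots> = (t + 1) * ((A + B) * \<rho> ^ Suc n)"
    proof -
      have "t * c = (t + 1) * (\<rho> * c)" for c using t by (simp add: \<rho>_def)
      then show ?thesis by (simp only: power_Suc mult.left_commute[of "A + B" \<rho>])
    qed
    finally show ?case
      using t by (simp add: mult_le_cancel_left_pos)
  qed
  have far: "d x = 0" if "x \<ge> t + 1" for x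
  proof -
    have "(\<lambda>n. (A + B) * \<rho> ^ n) \<longlonglongrightarrow> (A + B) * 0"
      using \<rho> by (intro tendsto_intros LIMSEQ_realpow_zero) auto
    then have "norm (d x) \<le> (A + B) * 0"
      by (rule tendsto_lowerbound[OF _ always_eventually]) (use geo[OF that] in auto)
    then show ?thesis by simp
  qed
  \<comment> \<open>Downward induction on x from t + 1: once d vanishes beyond x,
    \<open>step\<close> with C = 0 forces d x = 0.\<close>
  have "d x = 0" if "x \<ge> 1" for x
    using that
  proof (induction "nat \<lceil>t + 1\<rceil> - x" arbitrary: x rule: less_induct)
    case less
    show ?case
    proof (cases "x \<ge> t + 1")
      case False
      have "norm (d y) \<le> 0" if "y > x" for y
        using less.hyps[of y] less.prems that False by (auto simp: less_diff_conv2) linarith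
      from step[OF this] have "real x * norm (d x) \<le> 0" by simp
      then show ?thesis using less.prems by (simp add: mult_le_0_iff)
    qed (rule far)
  qed
  from this[OF x] show ?thesis by (simp add: d_def)
qed

section \<open>Numerical comparison with the claimed bounds\<close>

text \<open>As 1 / (2 \<delta>) equals \<open>sqrt pi * exp (1.5 * D) / D\<close>, both claims
  reduce to D being at most a constant times the exponential of a small multiple of D.\<close>

lemma stein_factor_numeric_bounds:
  fixes D \<delta> :: real
  assumes D: "D > 0" and \<delta>: "\<delta> = D / (2 * sqrt pi * exp (3 / 2 * D))"
  shows "exp (0.74 * D) \<le> 2 * sqrt (2 / \<delta>)"
    and "2 * exp (0.74 * D) \<le> 1 / (2 * \<delta>) * (1 + log_plus (pi * \<delta>))"
proof -
  have "sqrt (1.7\<^sup>2) \<le> sqrt pi"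
    using pi_gt3 by (intro real_sqrt_le_mono) (simp add: power2_eq_square)
  then have pi: "sqrt pi \<ge> 1.7" by simp
  have growth: "4 * u \<le> exp (2 * u)" if "u > 0" for u :: real
  proof -
    have "4 * u \<le> (1 + u)\<^sup>2"
      using sum_squares_ge_zero[of "1 - u" 0] by (simp add: power2_eq_square algebra_simps)
    also have "\<dots> \<le> (exp u)\<^sup>2"
      using that by (intro power_mono exp_ge_add_one_self) auto
    finally show ?thesis by (simp add: exp_double)
  qed
  have \<delta>_pos: "\<delta> > 0" using D \<delta> by simp
  have inv: "1 / (2 * \<delta>) = sqrt pi * exp (1.5 * D) / D"
    using D by (simp add: \<delta> field_simps)
  \<comment> \<open>Here 0.76 = 1.5 - 0.74, and 1.7 * 4 * 0.38 > 2.\<close>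
  have "2 * D \<le> sqrt pi * exp (0.76 * D)"
    using mult_mono[OF pi growth[of "0.38 * D"]] D by simp
  from mult_right_mono[OF this, of "exp (0.74 * D)"]
  have "2 * exp (0.74 * D) \<le> 1 / (2 * \<delta>)"
    using D unfolding inv by (simp add: field_simps mult_exp_exp)
  also have "\<dots> \<le> 1 / (2 * \<delta>) * (1 + log_plus (pi * \<delta>))"
    using \<delta>_pos by (intro mult_le_cancel_left1[THEN iffD2]) (auto simp: log_plus_def)
  finally show "2 * exp (0.74 * D) \<le> 1 / (2 * \<delta>) * (1 + log_plus (pi * \<delta>))" .
  \<comment> \<open>The first bound is squared: 0.02 = 1.5 - 2 * 0.74, and 16 * 1.7 * 4 * 0.01 >
    1.\<close>
  have "D \<le> 16 * (sqrt pi * exp (0.02 * D))"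
    using mult_mono[OF pi growth[of "0.01 * D"]] D by simp
  from mult_right_mono[OF this, of "exp (1.48 * D)"]
  have "exp (1.48 * D) \<le> 16 * (1 / (2 * \<delta>))"
    using D unfolding inv by (simp add: field_simps mult_exp_exp)
  also have "\<dots> = (2 * sqrt (2 / \<delta>))\<^sup>2"
    using \<delta>_pos by (simp add: power_mult_distrib)
  finally have "(exp (0.74 * D))\<^sup>2 \<le> (2 * sqrt (2 / \<delta>))\<^sup>2"
    by (simp add: power2_eq_square mult_exp_exp)
  then show "exp (0.74 * D) \<le> 2 * sqrt (2 / \<delta>)"
    by (rule power2_le_imp_le) (use \<delta>_pos in simp)
qed

section \<open>Identification of the Stein solution and conclusion\<close>

text \<open>The moment summands vanish at j = 0, so the unordered sums over \<open>{1..}\<close> are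
  series over all naturals.\<close>

lemma jump_rates_cp_rate:
  assumes lam: "lam > 0"
    and sum0: "(\<lambda>j. real j * cp_rate lam mu j) summable_on {1..}"
    and sum1: "(\<lambda>j. real j * (real j - 1) * cp_rate lam mu j) summable_on {1..}"
    and mu0: "pmf mu 0 = 0"
  shows "jump_rates (cp_rate lam mu)"
    and "jump_rates.\<theta>0 (cp_rate lam mu) = cp_theta0 lam mu"
    and "jump_rates.\<theta>1 (cp_rate lam mu) = cp_theta1 lam mu"
    and "\<And>z. norm z \<le> 1 \<Longrightarrow> jump_rates.\<Lambda> (cp_rate lam mu) z =
           of_real lam * measure_pmf.expectation mu (\<lambda>k. z ^ k)"
proof -
  have sums: "f sums infsum f {1..}" if "f summable_on {1..}" "f 0 = 0" for f :: "nat \<Rightarrow> real"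
  proof -
    have "(f has_sum infsum f {1..}) {1..}" using that(1) by (rule has_sum_infsum)
    also have "?this \<longleftrightarrow> (f has_sum infsum f {1..}) UNIV"
      using that(2) by (intro has_sum_cong_neutral) (auto simp: not_le)
    finally show ?thesis by (rule has_sum_imp_sums)
  qed
  from sums[OF sum0] sums[OF sum1]
  have s0: "(\<lambda>j. real j * cp_rate lam mu j) sums cp_theta0 lam mu"
    and s1: "(\<lambda>j. real j * (real j - 1) * cp_rate lam mu j) sums cp_theta1 lam mu"
    by (simp_all add: cp_theta0_def cp_theta1_def)
  show rates: "jump_rates (cp_rate lam mu)"
    by unfold_locales (use lam mu0 s0 s1 in \<open>auto simp: cp_rate_def sums_iff\<close>)
  show "jump_rates.\<theta>0 (cp_rate lam mu) = cp_theta0 lam mu"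
    "jump_rates.\<theta>1 (cp_rate lam mu) = cp_theta1 lam mu"
    using s0 s1 by (simp_all add: jump_rates.\<theta>0_def[OF rates] jump_rates.\<theta>1_def[OF rates] sums_iff)
  show "jump_rates.\<Lambda> (cp_rate lam mu) z = of_real lam * measure_pmf.expectation mu (\<lambda>k. z ^ k)"
    if "norm z \<le> 1" for z
    using sums_mult[OF pmf_nat_expectation_sums[of "\<lambda>k. z ^ k" 1 mu], of "of_real lam"] that
    by (simp add: jump_rates.\<Lambda>_def[OF rates] cp_rate_def sums_iff norm_power power_le_one mult.assoc)
qed

text \<open>The real parts of the coefficients form a bounded solution, which uniqueness identifies
  with \<open>stein_solution\<close>; the coefficient bound then applies.\<close>

lemma kolmogorov_stein_solution_bound:
  assumes lam: "lam > 0" and mu0: "pmf mu 0 = 0"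
    and sum0: "(\<lambda>j. real j * cp_rate lam mu j) summable_on {1..}"
    and sum1: "(\<lambda>j. real j * (real j - 1) * cp_rate lam mu j) summable_on {1..}"
    and D: "2 * cp_theta1 lam mu - cp_theta0 lam mu > 0"
    and x: "x \<ge> 1"
  shows "\<bar>stein_solution lam mu (indicator {..y}) x\<bar>
           \<le> exp (0.74 * (2 * cp_theta1 lam mu - cp_theta0 lam mu))"
proof -
  let ?U = "compound_poisson_pmf lam mu" and ?h = "indicator {..y} :: nat \<Rightarrow> real"
  let ?B = "exp (0.74 * (2 * cp_theta1 lam mu - cp_theta0 lam mu))"
  note rates = jump_rates_cp_rate[OF lam sum0 sum1 mu0]
  interpret jump_rates "cp_rate lam mu" by (rule rates)
  have D': "2 * \<theta>1 - \<theta>0 > 0" using D rates(2,3) by simp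
  \<comment> \<open>The value 0 at x = 0 matches the normalisation in
    \<open>stein_solution\<close>.\<close>
  define f where "f = (\<lambda>x. if x = 0 then 0 else Re (stein_coeff y x))"
  have f_bound: "\<bar>f x\<bar> \<le> ?B" for x
    using norm_stein_coeff_le[OF D', where y = y and x = x] abs_Re_le_cmod[of "stein_coeff y x"] rates(2,3)
    by (simp add: f_def)
  have equation: "?h x - measure_pmf.expectation ?U ?h =
        (\<Sum>\<^sub>\<infinity>j\<in>{1..}. real j * cp_rate lam mu j * f (x + j)) - real x * f x" for x
  proof -
    let ?r = "Abs_fps (\<lambda>y. of_real (indicator {..y} x - measure_pmf.expectation ?U (indicator {..y})) :: complex)"
    \<comment> \<open>A power series expansion depends only on values near 0, so the generating
      function formula in the unit disc suffices; it uses \<open>\<Lambda> 1 = lam\<close>.\<close>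
    have "\<forall>\<^sub>F z in nhds 0. z \<in> ball (0 :: complex) 1"
      by (intro eventually_nhds_in_open) auto
    then have "\<forall>\<^sub>F z in nhds 0. (z ^ x - exp (\<Lambda> z - \<Lambda> 1)) / (1 - z) =
        (z ^ x - measure_pmf.expectation ?U (\<lambda>k. z ^ k)) / (1 - z)"
      by eventually_elim (simp add: compound_poisson_pgf[OF lam] rates(4))
    from has_fps_expansion_cong[OF this refl, THEN iffD2, OF cdf_gf_has_fps_expansion]
    have "(\<lambda>j. of_real (real j * cp_rate lam mu j) * stein_coeff y (x + j)) sums
           (fps_nth ?r y + of_nat x * stein_coeff y x)"
      by (rule stein_coeff_sums[OF D'])
    from sums_Re[OF this]
    have "(\<lambda>j. real j * cp_rate lam mu j * Re (stein_coeff y (x + j))) sums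
            (?h x - measure_pmf.expectation ?U ?h + real x * Re (stein_coeff y x))"
      by simp
    also have "(\<lambda>j. real j * cp_rate lam mu j * Re (stein_coeff y (x + j))) =
               (\<lambda>j. real j * cp_rate lam mu j * f (x + j))"
      by (auto simp: f_def)
    also have "real x * Re (stein_coeff y x) = real x * f x"
      by (simp add: f_def)
    finally have sums: "(\<lambda>j. real j * cp_rate lam mu j * f (x + j)) sums
            (?h x - measure_pmf.expectation ?U ?h + real x * f x)" .
    \<comment> \<open>Absolute convergence turns the series into the unordered sum of the Stein
      equation.\<close>
    have "summable (\<lambda>j. norm (real j * cp_rate lam mu j * f (x + j)))"
    proof (rule summable_comparison_test'[OF summable_mult2[OF summable_theta0, of ?B]])
      show "norm (norm (real j * cp_rate lam mu j * f (x + j))) \<le> real j * cp_rate lam mu j * ?B" for j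
        using mult_left_mono[OF f_bound, of "real j * cp_rate lam mu j" "x + j"] rate_nonneg[of j]
        by (simp add: abs_mult)
    qed
    from norm_summable_imp_has_sum[OF this sums]
    have "((\<lambda>j. real j * cp_rate lam mu j * f (x + j)) has_sum
            (?h x - measure_pmf.expectation ?U ?h + real x * f x)) UNIV" .
    also have "?this \<longleftrightarrow> ((\<lambda>j. real j * cp_rate lam mu j * f (x + j)) has_sum
            (?h x - measure_pmf.expectation ?U ?h + real x * f x)) {1..}"
      by (intro has_sum_cong_neutral) (auto simp: not_le)
    finally show ?thesis by (simp add: infsumI)
  qed
  have f: "bounded_stein_solution lam mu ?h f"
    unfolding bounded_stein_solution_def using f_bound equation
    by (auto simp: bounded_iff intro!: exI[of _ ?B])
  have "stein_solution lam mu ?h = f"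
    unfolding stein_solution_def
  proof (rule the_equality)
    show "bounded_stein_solution lam mu ?h f \<and> f 0 = 0" using f by (simp add: f_def)
    show "g = f" if g: "bounded_stein_solution lam mu ?h g \<and> g 0 = 0" for g
    proof
      show "g x = f x" for x
        using bounded_stein_solution_unique[OF lam sum0 _ f, of g x] g
        by (cases "x = 0") (auto simp: f_def)
    qed
  qed
  then show ?thesis using f_bound by simp
qed

theorem theorem7:
  fixes lam \<delta> :: real and mu :: "nat pmf"
  assumes "lam > 0"
    and "pmf mu 0 = 0"
    and "(\<lambda>j. real j * cp_rate lam mu j) summable_on {1..}"
    and "(\<lambda>j. real j * (real j - 1) * cp_rate lam mu j) summable_on {1..}"
    and "2 * cp_theta1 lam mu > cp_theta0 lam mu"
    and "\<delta> = (2 * cp_theta1 lam mu - cp_theta0 lam mu) /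
             (2 * sqrt pi * exp (3 / 2 * (2 * cp_theta1 lam mu - cp_theta0 lam mu)))"
  shows "kolmogorov_stein_factor 0 lam mu \<le> ereal (2 * sqrt (2 / \<delta>)) \<and>
         kolmogorov_stein_factor 1 lam mu \<le> ereal (1 / (2 * \<delta>) * (1 + log_plus (pi * \<delta>)))"
proof -
  have D: "2 * cp_theta1 lam mu - cp_theta0 lam mu > 0"
    using assms(5) by simp
  note numeric = stein_factor_numeric_bounds[OF D assms(6)]
  note bound = kolmogorov_stein_solution_bound[OF assms(1-4) D]
  have "\<bar>(fwd_diff ^^ 0) (stein_solution lam mu h) x\<bar> \<le> 2 * sqrt (2 / \<delta>)"
    if h: "h \<in> kolmogorov_tests" and x: "x \<ge> 1" for h x
  proof -
    obtain y where "h = indicator {..y}" using h by (auto simp: kolmogorov_tests_def)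
    then show ?thesis using bound[OF x, of y] numeric(1) by simp
  qed
  moreover have "\<bar>(fwd_diff ^^ 1) (stein_solution lam mu h) x\<bar> \<le> 1 / (2 * \<delta>) * (1 + log_plus (pi * \<delta>))"
    if h: "h \<in> kolmogorov_tests" and x: "x \<ge> 1" for h x
  proof -
    obtain y where h: "h = indicator {..y}" using h by (auto simp: kolmogorov_tests_def)
    \<comment> \<open>The difference is bounded by the triangle inequality, which accounts for the
      factor 2 in \<open>numeric(2)\<close>.\<close>
    have "x + 1 \<ge> 1" by simp
    from bound[OF this, of y] bound[OF x, of y] numeric(2) show ?thesis
      by (simp add: fwd_diff_def h abs_le_iff)
  qed
  ultimately show ?thesis
    unfolding kolmogorov_stein_factor_def by (auto intro!: SUP_least)
qed

end
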